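(* Consider the planar ($d=2$) Boolean model whose grains are discs centred at the germs with deterministic constant radius $R>0$. For each $\mu\in(0,2/R)$ there exists a function $\varepsilon_\mu$ with $\varepsilon_\mu(r)\to0$ as $r\to\infty$ such that, for $r$ large enough, $$\mathbb P\left(\mathfrak V\ge r\right)\ge \mu\, r\,\exp(-2Rr)\left(1+\varepsilon_\mu(r)\right).$$
   Context: Let $\mathbf X$ be a homogeneous Poisson point process in $\mathbb R^2$ with intensity measure the Lebesgue measure. The occupied phase is $\mathfrak O=\bigcup_{x\in\mathbf X}B_2(x,R)$, where $B_2(x,R)$ is the disc of centre $x$ and radius $R$. The model is conditioned on the event $\{O\notin\mathfrak O\}$ (of positive probability), where $O$ is the origin; $\mathbb P$ denotes the probability under this conditioning. For a unit vector $\mathbf u$, $V(\mathbf u)=\inf\{s>0: s\mathbf u\in\mathfrak O\}$ (with $\inf\emptyset=+\infty$), and the total visibility is $\mathfrak V=\sup_{\|\mathbf u\|=1}V(\mathbf u)$. *)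

theory Defs
  imports "HOL-Probability.Probability"
begin

(* Homogeneous Poisson point process whose intensity measure is Lebesgue measure. Since
   the intensity is atomless the process is simple, so a realisation is a locally finite
   set of points (no multiplicities). The Poisson law is written out rather than taken
   from poisson_pmf because that needs a positive rate, and A may be a null set. *)
locale poisson_process = prob_space M for M :: "'w measure" +
  fixes X :: "'w \<Rightarrow> 'a::euclidean_space set"
  assumes locally_finite:
      "\<And>\<omega> A. \<omega> \<in> space M \<Longrightarrow> bounded A \<Longrightarrow> finite (X \<omega> \<inter> A)"
    and count_measurable:
      "\<And>A. A \<in> sets borel \<Longrightarrow> bounded A \<Longrightarrow>
        (\<lambda>\<omega>. card (X \<omega> \<inter> A)) \<in> measurable M (count_space UNIV)"
    and count_poisson:
      "\<And>A k. A \<in> sets borel \<Longrightarrow> bounded A \<Longrightarrow>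
        \<P>(\<omega> in M. card (X \<omega> \<inter> A) = k)
          = exp (- measure lborel A) * measure lborel A ^ k / fact k"
    and count_indep:
      "\<And>(A :: nat \<Rightarrow> 'a set) I. finite I \<Longrightarrow> disjoint_family_on A I \<Longrightarrow>
        (\<And>i. i \<in> I \<Longrightarrow> A i \<in> sets borel \<and> bounded (A i)) \<Longrightarrow>
        indep_vars (\<lambda>_. count_space UNIV) (\<lambda>i \<omega>. card (X \<omega> \<inter> A i)) I"

definition occupied_phase :: "real \<Rightarrow> 'a::euclidean_space set \<Rightarrow> 'a set" where
  "occupied_phase R S = (\<Union>x\<in>S. cball x R)"

(* Inf {} = \<infinity> in ereal. *)
definition visibility :: "'a::real_normed_vector set \<Rightarrow> 'a \<Rightarrow> ereal" where
  "visibility Occ u = Inf {ereal s | s. s > 0 \<and> s *\<^sub>R u \<in> Occ}"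

definition total_visibility :: "'a::real_normed_vector set \<Rightarrow> ereal" where
  "total_visibility Occ = (SUP u\<in>{u. norm u = 1}. visibility Occ u)"

end

(*
  Visibility at least r holds as soon as the tube of radius R around the segment [0, r u] contains
  no germ for some direction u. Its area is at most 2Rr + pi R^2, of which pi R^2 is accounted for
  by the conditioning. Take about mu r directions with angles in [0,1), at mutual distance at least
  of order 1/r: the far half of one tube then protrudes from any other by a strip of constant width
  eta, so two tubes are both vacant with probability at most exp(-eta r/2) times that for one.
  Bonferroni's inequality loses only a relative error of order r exp(-eta r/2).
  The visibility event is measurable because a vacant direction can be perturbed, so that
  countably many directions and rational distances below r suffice.
*)
theory Submission
  imports Defs "HOL-Real_Asymp.Real_Asymp"
begin

section \<open>Vacant tubes and visibility for a fixed set of germs\<close>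

definition tube :: "real \<Rightarrow> real \<Rightarrow> 'a::euclidean_space \<Rightarrow> 'a set" where
  "tube R r u = (\<Union>t\<in>{0..r}. cball (t *\<^sub>R u) R)"

text \<open>The Minkowski sum of a segment and a ball makes compactness immediate: both summands are
  compact.\<close>

lemma tube_eq_sums:
  "tube R r u = {x + y | x y. x \<in> (\<lambda>t. t *\<^sub>R u) ` {0..r} \<and> y \<in> cball 0 R}"
proof -
  have "x \<in> cball c R \<longleftrightarrow> (\<exists>y\<in>cball 0 R. x = c + y)" for x c :: 'a
    by (auto simp: dist_norm norm_minus_commute intro!: bexI[of _ "x - c"])
  then show ?thesis
    unfolding tube_def by (auto simp: mem_cball_0) (metis atLeastAtMost_iff imageI)+
qed

lemma compact_tube: "compact (tube R r u)"
  unfolding tube_eq_sums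
  by (intro compact_sums compact_continuous_image continuous_intros) auto

lemma tube_sets_borel [measurable]: "tube R r u \<in> sets borel"
  by (simp add: borel_closed compact_imp_closed compact_tube)

lemma bounded_tube: "bounded (tube R r u)"
  by (simp add: compact_imp_bounded compact_tube)

lemma tube_disjoint_iff:
  "S \<inter> tube R r u = {} \<longleftrightarrow> (\<forall>t\<in>{0..r}. t *\<^sub>R u \<notin> occupied_phase R S)"
  by (fastforce simp: tube_def occupied_phase_def dist_commute)

text \<open>When the tube is vacant, every occupied point \<open>s *\<^sub>R u\<close> with
  \<open>s > 0\<close> has \<open>s > r\<close>, so \<open>r\<close> is a lower bound for the set
  defining \<open>visibility\<close>. This also covers the empty set, where the infimum is
  infinite.\<close>

lemma total_visibility_ge:
  assumes "norm u = 1" and "S \<inter> tube R r u = {}"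
  shows "total_visibility (occupied_phase R S) \<ge> ereal r"
proof -
  have "ereal r \<le> visibility (occupied_phase R S) u"
    unfolding visibility_def
  proof (rule Inf_greatest)
    fix x assume "x \<in> {ereal s |s. 0 < s \<and> s *\<^sub>R u \<in> occupied_phase R S}"
    then obtain s where s: "x = ereal s" "0 < s" "s *\<^sub>R u \<in> occupied_phase R S"
      by auto
    then have "\<not> s \<le> r"
      using assms(2) by (auto simp: tube_disjoint_iff)
    then show "ereal r \<le> x" using s by simp
  qed
  also have "\<dots> \<le> total_visibility (occupied_phase R S)"
    unfolding total_visibility_def using assms(1) by (intro SUP_upper) auto
  finally show ?thesis .
qed

text \<open>The supremum need not be attained, so a strict inequality is needed to extract one
  direction that is clear up to distance \<open>q\<close>. Since \<open>visibility\<close> only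
  tests \<open>s > 0\<close>, the start of the segment is covered by the hypothesis on the
  origin.\<close>

lemma total_visibility_gtE:
  assumes "total_visibility (occupied_phase R S) > ereal q" "0 \<notin> occupied_phase R S"
  obtains u where "norm u = 1" "S \<inter> tube R q u = {}"
proof -
  obtain u where u: "norm u = 1" "visibility (occupied_phase R S) u > ereal q"
    using assms(1) unfolding total_visibility_def less_SUP_iff by auto
  have "t *\<^sub>R u \<notin> occupied_phase R S" if "t \<in> {0..q}" for t
  proof
    assume occ: "t *\<^sub>R u \<in> occupied_phase R S"
    then have "t > 0" using assms(2) that by (cases "t = 0") auto
    then have "visibility (occupied_phase R S) u \<le> ereal t"
      unfolding visibility_def using occ by (intro Inf_lower) auto
    also have "\<dots> \<le> ereal q" using that by simp
    finally show False using u(2) by simp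
  qed
  then show ?thesis using that u(1) unfolding tube_disjoint_iff by blast
qed

text \<open>Vacancy is an open condition on the direction: only finitely many germs are near, so the
  compact tube keeps a distance \<open>e > 0\<close> from them, and turning \<open>u\<close> by less
  than \<open>e / q\<close> moves each axis point by less than \<open>e\<close>.\<close>

lemma tube_disjoint_perturb:
  fixes S :: "'a::euclidean_space set"
  assumes fin: "\<And>A. bounded A \<Longrightarrow> finite (S \<inter> A)"
    and u: "norm u = 1" and disj: "S \<inter> tube R q u = {}" and "q > 0"
    and T: "T \<subseteq> sphere 0 1" "sphere 0 1 \<subseteq> closure T"
  obtains d where "d \<in> T" "S \<inter> tube R q d = {}"
proof -
  \<comment> \<open>Every tube of length \<open>q\<close> with unit direction lies in this ball, so
    germs outside it are irrelevant before and after the perturbation.\<close>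
  define F where "F = S \<inter> cball 0 (q + R)"
  have "closed F"
    unfolding F_def by (intro finite_imp_closed fin) simp
  moreover have "tube R q u \<inter> F = {}" using disj by (auto simp: F_def)
  ultimately obtain e where e: "e > 0" "\<And>x y. x \<in> tube R q u \<Longrightarrow> y \<in> F \<Longrightarrow> e \<le> dist x y"
    using separate_compact_closed[OF compact_tube] by metis
  have "u \<in> closure T" using T u by auto
  then obtain d where d: "d \<in> T" "dist d u < e / q"
    using e(1) \<open>q > 0\<close> by (meson closure_approachable divide_pos_pos)
  have "x \<notin> tube R q d" if "x \<in> S" for x
  proof
    assume "x \<in> tube R q d"
    then obtain t where t: "t \<in> {0..q}" "norm (x - t *\<^sub>R d) \<le> R"
      by (auto simp: tube_def dist_norm norm_minus_commute)
    have "norm d = 1" using T d by auto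
    have "norm x \<le> norm (t *\<^sub>R d) + norm (x - t *\<^sub>R d)"
      by (metis add.commute diff_add_cancel norm_triangle_ineq)
    also have "\<dots> \<le> q + R" using t \<open>norm d = 1\<close> by simp
    finally have "x \<in> F" using that by (simp add: F_def)
    \<comment> \<open>The offset of \<open>x\<close> from the new axis is copied to the old axis.
      Thus \<open>y\<close> lies in the old tube, and its distance to the germ \<open>x\<close> is
      only the displacement of the axis point.\<close>
    define y where "y = t *\<^sub>R u + (x - t *\<^sub>R d)"
    have "y \<in> tube R q u"
      unfolding tube_def using t by (auto simp: y_def dist_norm norm_minus_commute intro!: bexI[of _ t])
    then have "e \<le> dist y x" using e \<open>x \<in> F\<close> by blast
    also have "dist y x = norm (t *\<^sub>R (u - d))"
      by (simp add: y_def dist_norm algebra_simps)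
    also have "\<dots> = t * dist d u" using t by (simp add: dist_norm norm_minus_commute)
    also have "\<dots> \<le> q * dist d u" using t by (intro mult_right_mono) auto
    also have "\<dots> < e" using d \<open>q > 0\<close> by (simp add: field_simps)
    finally show False by simp
  qed
  then show ?thesis using d that by blast
qed

text \<open>For each \<open>q < r\<close> some direction is clear strictly beyond \<open>q\<close>,
  and it can be moved into \<open>T\<close>. Conversely, clear tubes of all rational lengths below
  \<open>r\<close> push the supremum up to \<open>r\<close>. Any one of them contains the ball about
  the origin, which gives the condition on the origin.\<close>

lemma total_visibility_ge_iff_countable:
  fixes S :: "'a::euclidean_space set"
  assumes fin: "\<And>A. bounded A \<Longrightarrow> finite (S \<inter> A)" and "r > 0"
    and T: "T \<subseteq> sphere 0 1" "sphere 0 1 \<subseteq> closure T"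
  shows "total_visibility (occupied_phase R S) \<ge> ereal r \<and> 0 \<notin> occupied_phase R S \<longleftrightarrow>
    (\<forall>q\<in>\<rat> \<inter> {0<..<r}. \<exists>d\<in>T. S \<inter> tube R q d = {})"
proof (intro iffI ballI)
  fix q assume tv: "total_visibility (occupied_phase R S) \<ge> ereal r \<and> 0 \<notin> occupied_phase R S"
    and q: "q \<in> \<rat> \<inter> {0<..<r}"
  then have "ereal q < total_visibility (occupied_phase R S)"
    by (metis IntD2 greaterThanLessThan_iff less_ereal.simps(1) order_less_le_trans)
  then obtain u where "norm u = 1" "S \<inter> tube R q u = {}"
    using tv total_visibility_gtE by blast
  then show "\<exists>d\<in>T. S \<inter> tube R q d = {}"
    using tube_disjoint_perturb[OF fin _ _ _ T] q by (metis IntD2 greaterThanLessThan_iff)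
next
  assume *: "\<forall>q\<in>\<rat> \<inter> {0<..<r}. \<exists>d\<in>T. S \<inter> tube R q d = {}"
  have "0 \<notin> occupied_phase R S"
  proof -
    obtain q where "q \<in> \<rat>" "0 < q" "q < r" using Rats_dense_in_real \<open>r > 0\<close> by blast
    with * obtain d where "S \<inter> tube R q d = {}" by fastforce
    then show ?thesis using \<open>0 < q\<close> unfolding tube_disjoint_iff
      by (metis atLeastAtMost_iff less_eq_real_def order_refl scaleR_zero_left)
  qed
  moreover have "ereal r \<le> total_visibility (occupied_phase R S)"
  proof (rule ccontr)
    assume "\<not> ?thesis"
    \<comment> \<open>Truncating at 0 makes the rational \<open>q\<close> found below positive, with
      no separate proof that total visibility is nonnegative.\<close>
    then have "max 0 (total_visibility (occupied_phase R S)) < ereal r"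
      using \<open>r > 0\<close> by (simp add: zero_ereal_def)
    then obtain q' where q': "max 0 (total_visibility (occupied_phase R S)) < ereal q'" "q' < r"
      by (metis ereal_dense2 less_ereal.simps(1))
    then have "0 < q'" by simp
    obtain q where q: "q \<in> \<rat>" "q' < q" "q < r" using Rats_dense_in_real q' by blast
    with * \<open>0 < q'\<close> obtain d where "d \<in> T" "S \<inter> tube R q d = {}" by fastforce
    then have "ereal q \<le> total_visibility (occupied_phase R S)"
      using T by (intro total_visibility_ge[of d]) auto
    also have "\<dots> < ereal q'" using q' by simp
    finally show False using q by simp
  qed
  ultimately show "total_visibility (occupied_phase R S) \<ge> ereal r \<and> 0 \<notin> occupied_phase R S"
    by blast
qed

section \<open>Bonferroni's inequality, void probabilities and measurability\<close>

lemma (in finite_measure) measure_UN_Bonferroni: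
  fixes A :: "nat \<Rightarrow> 'a set"
  assumes [measurable]: "\<And>i. A i \<in> sets M"
  shows "measure M (\<Union>i<n. A i)
    \<ge> (\<Sum>i<n. measure M (A i)) - (\<Sum>j<n. \<Sum>i<j. measure M (A i \<inter> A j))"
proof (induction n)
  case (Suc n)
  have "measure M (\<Union>i<Suc n. A i) = measure M ((\<Union>i<n. A i) \<union> A n)"
    by (simp add: lessThan_Suc Un_commute)
  also have "\<dots> = measure M (\<Union>i<n. A i) + measure M (A n) - measure M ((\<Union>i<n. A i) \<inter> A n)"
    by (subst measure_Un3) (auto simp: fmeasurable_eq_sets)
  finally have union: "measure M (\<Union>i<Suc n. A i) = \<dots>" .
  \<comment> \<open>By the union bound, the new event loses at most its pairwise overlaps with the
    earlier ones, which form the row \<open>j = n\<close> of the double sum.\<close>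
  have "measure M ((\<Union>i<n. A i) \<inter> A n) = measure M (\<Union>i<n. A i \<inter> A n)"
    by (rule arg_cong[where f = "measure M"]) auto
  also have "\<dots> \<le> (\<Sum>i<n. measure M (A i \<inter> A n))"
    by (intro finite_measure_subadditive_finite) auto
  finally show ?case using Suc union by simp
qed simp

context poisson_process
begin

lemma void_event:
  assumes "A \<in> sets borel" "bounded A"
  shows "{\<omega>\<in>space M. X \<omega> \<inter> A = {}} \<in> sets M"
    and "prob {\<omega>\<in>space M. X \<omega> \<inter> A = {}} = exp (- measure lborel A)"
proof -
  \<comment> \<open>An infinite set has \<open>card\<close> 0, so local finiteness is what makes a
    zero count mean emptiness.\<close>
  have eq: "{\<omega>\<in>space M. X \<omega> \<inter> A = {}} = {\<omega>\<in>space M. card (X \<omega> \<inter> A) = 0}"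
    using locally_finite[OF _ assms(2)] by auto
  note [measurable] = count_measurable[OF assms]
  show "{\<omega>\<in>space M. X \<omega> \<inter> A = {}} \<in> sets M"
    unfolding eq by measurable
  show "prob {\<omega>\<in>space M. X \<omega> \<inter> A = {}} = exp (- measure lborel A)"
    unfolding eq count_poisson[OF assms] by simp
qed

lemma total_visibility_event_sets:
  assumes "r > 0"
  shows "{\<omega>\<in>space M. total_visibility (occupied_phase R (X \<omega>)) \<ge> ereal r
    \<and> 0 \<notin> occupied_phase R (X \<omega>)} \<in> sets M"
proof -
  obtain T :: "'a set" where T: "countable T" "T \<subseteq> sphere 0 1" "sphere 0 1 \<subseteq> closure T"
    using separable[of "sphere 0 1 :: 'a set"] by metis
  have eq: "{\<omega>\<in>space M. total_visibility (occupied_phase R (X \<omega>)) \<ge> ereal r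
      \<and> 0 \<notin> occupied_phase R (X \<omega>)} =
    {\<omega>\<in>space M. \<forall>q\<in>\<rat> \<inter> {0<..<r}. \<exists>d\<in>T. X \<omega> \<inter> tube R q d = {}}"
    using total_visibility_ge_iff_countable[OF locally_finite assms T(2,3)] by blast
  show ?thesis
    unfolding eq
    by (intro sets.sets_Collect_countable_All' sets.sets_Collect_countable_Ex' T(1)
        void_event(1) tube_sets_borel bounded_tube countable_Int1 countable_rat)
qed

end

section \<open>Areas of planar tubes\<close>

definition perp :: "real^2 \<Rightarrow> real^2" where
  "perp u = vector [- u $ 2, u $ 1]"

text \<open>For a unit vector \<open>u\<close> this is the rotation taking the first coordinate axis
  to the direction \<open>u\<close>. It reduces area computations to boxes parallel to the
  axes.\<close>

definition frame :: "real^2 \<Rightarrow> real^2 \<Rightarrow> real^2" where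
  "frame u x = x $ 1 *\<^sub>R u + x $ 2 *\<^sub>R perp u"

lemma norm_sq_2: "(norm (x :: real^2))\<^sup>2 = (x $ 1)\<^sup>2 + (x $ 2)\<^sup>2"
  unfolding power2_norm_eq_inner by (simp add: inner_vec_def sum_2 power2_eq_square)

lemma norm_perp [simp]: "norm (perp u) = norm u"
proof -
  have "(norm (perp u))\<^sup>2 = (norm u)\<^sup>2"
    unfolding norm_sq_2 by (simp add: perp_def)
  then show ?thesis by simp
qed

lemma orthogonal_transformation_frame:
  assumes "norm u = 1"
  shows "orthogonal_transformation (frame u)"
  unfolding orthogonal_transformation
proof (intro conjI allI)
  show "linear (frame u)"
    by (rule linearI) (simp_all add: frame_def algebra_simps)
  fix x
  have "(norm (frame u x))\<^sup>2 = ((x $ 1)\<^sup>2 + (x $ 2)\<^sup>2) * ((u $ 1)\<^sup>2 + (u $ 2)\<^sup>2)"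
    unfolding norm_sq_2 by (simp add: frame_def perp_def power2_eq_square algebra_simps)
  also have "(u $ 1)\<^sup>2 + (u $ 2)\<^sup>2 = 1"
    using norm_sq_2[of u] assms by simp
  finally have "(norm (frame u x))\<^sup>2 = (norm x)\<^sup>2"
    using norm_sq_2[of x] by simp
  then show "norm (frame u x) = norm x"
    by (rule power2_eq_imp_eq) simp_all
qed

lemma compact_frame_image:
  assumes "norm u = 1" "compact S"
  shows "compact (frame u ` S)"
  using linear_continuous_on_compose[OF continuous_on_id
      orthogonal_transformation_linear[OF orthogonal_transformation_frame[OF assms(1)]]] assms(2)
  by (rule compact_continuous_image)

text \<open>Invariance under orthogonal maps is applied to the completed measure
  \<open>lebesgue\<close>; compact sets are Borel, so there it agrees with
  \<open>lborel\<close>.\<close>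

lemma measure_frame_image:
  assumes "norm u = 1" "compact S"
  shows "measure lborel (frame u ` S) = measure lborel S"
proof -
  have *: "measure lborel K = measure lebesgue K" if "compact K" for K :: "(real^2) set"
    using that by (simp add: borel_closed compact_imp_closed)
  have orth: "orthogonal_transformation (frame u)"
    by (rule orthogonal_transformation_frame[OF assms(1)])
  have "compact (frame u ` S)"
    by (rule compact_frame_image[OF assms])
  then have "measure lborel (frame u ` S) = measure lebesgue (frame u ` S)" by (rule *)
  also have "\<dots> = measure lebesgue S"
    by (intro measure_orthogonal_image orth lmeasurable_compact assms)
  also have "\<dots> = measure lborel S" by (rule *[OF assms(2), symmetric])
  finally show ?thesis .
qed

lemma frame_image_tube:
  assumes "norm u = 1"
  shows "frame u ` tube R r (axis 1 1) = tube R r u"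
proof -
  have "frame u (t *\<^sub>R axis 1 1) = t *\<^sub>R u" for t
    by (simp add: frame_def axis_def)
  then show ?thesis
    unfolding tube_def image_UN
    by (simp add: image_orthogonal_transformation_cball orthogonal_transformation_frame assms)
qed

text \<open>After rotation, the tube is cut at abscissas 0 and \<open>r\<close>. The middle lies in
  a rectangle of area \<open>2 * R * r\<close>, and the two caps are half discs that fit together
  into one disc.\<close>

lemma measure_tube_le:
  fixes u :: "real^2"
  assumes "norm u = 1" "R > 0" "r \<ge> 0"
  shows "measure lborel (tube R r u) \<le> 2 * R * r + pi * R\<^sup>2"
proof -
  define e where "e = (axis 1 1 :: real^2)"
  define L where "L = cball (0 :: real^2) R \<inter> {x. x $ 1 < 0}"
  define P where "P = cball (0 :: real^2) R \<inter> {x. x $ 1 > 0}"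
  define Q where "Q = cbox (vector [0, -R] :: real^2) (vector [r, R])"
  have "{x :: real^2. x $ 1 < 0} \<in> sets lebesgue" "{x :: real^2. x $ 1 > 0} \<in> sets lebesgue"
    by (simp_all add: open_halfspace_component_lt_cart open_halfspace_component_gt_cart)
  then have [simp]: "L \<in> lmeasurable" "P \<in> lmeasurable" "Q \<in> lmeasurable"
    unfolding L_def P_def Q_def
    by (simp_all add: fmeasurable_Int_fmeasurable)
  have sub: "tube R r e \<subseteq> L \<union> Q \<union> (+) (r *\<^sub>R e) ` P"
  proof
    fix x assume "x \<in> tube R r e"
    then obtain t where t: "0 \<le> t" "t \<le> r" "norm (x - t *\<^sub>R e) \<le> R"
      by (auto simp: tube_def dist_norm norm_minus_commute)
    have "(norm (x - t *\<^sub>R e))\<^sup>2 \<le> R\<^sup>2"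
      using t by (intro power_mono) auto
    then have sq: "(x $ 1 - t)\<^sup>2 + (x $ 2)\<^sup>2 \<le> R\<^sup>2"
      by (simp add: norm_sq_2 e_def axis_def)
    have in_ball: "y \<in> cball 0 R" if "(y $ 1)\<^sup>2 + (y $ 2)\<^sup>2 \<le> R\<^sup>2" for y :: "real^2"
      using that \<open>R > 0\<close> unfolding norm_sq_2[symmetric] by (simp add: power2_le_iff_abs_le)
    consider "x $ 1 < 0" | "0 \<le> x $ 1" "x $ 1 \<le> r" | "x $ 1 > r" by linarith
    then show "x \<in> L \<union> Q \<union> (+) (r *\<^sub>R e) ` P"
    proof cases
      case 1
      \<comment> \<open>To the left of 0 the nearest axis point is the origin, so \<open>x\<close>
        is already in the ball about it. Case 3 is the same at the other end.\<close>
      then have "(x $ 1)\<^sup>2 \<le> (x $ 1 - t)\<^sup>2"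
        using t by (intro abs_le_square_iff[THEN iffD1]) auto
      then have "x \<in> L" using 1 sq in_ball[of x] by (simp add: L_def)
      then show ?thesis by simp
    next
      case 2
      have "(x $ 2)\<^sup>2 \<le> R\<^sup>2" using sq zero_le_power2[of "x $ 1 - t"] by linarith
      then have "\<bar>x $ 2\<bar> \<le> R" using \<open>R > 0\<close> by (simp add: power2_le_iff_abs_le)
      then have "x \<in> Q" using 2 by (simp add: Q_def mem_box_cart forall_2 abs_le_iff)
      then show ?thesis by simp
    next
      case 3
      define y where "y = x - r *\<^sub>R e"
      have y: "y $ 1 = x $ 1 - r" "y $ 2 = x $ 2" by (simp_all add: y_def e_def axis_def)
      have "(x $ 1 - r)\<^sup>2 \<le> (x $ 1 - t)\<^sup>2" using 3 t by (intro power_mono) auto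
      then have "y \<in> P" using 3 sq in_ball[of y] by (simp add: P_def y)
      moreover have "x = r *\<^sub>R e + y" by (simp add: y_def)
      ultimately show ?thesis by blast
    qed
  qed
  have Q: "measure lebesgue Q = 2 * R * r"
  proof -
    have "Q \<noteq> {}" unfolding Q_def using assms by (simp add: interval_ne_empty_cart forall_2)
    then show ?thesis unfolding Q_def by (simp add: content_cbox_cart UNIV_2)
  qed
  have "measure lebesgue (tube R r e) \<le> measure lebesgue (L \<union> Q \<union> (+) (r *\<^sub>R e) ` P)"
    by (intro measure_mono_fmeasurable sub fmeasurable.Un)
       (simp_all add: fmeasurableD compact_tube lmeasurable_compact measurable_translation)
  also have "\<dots> \<le> measure lebesgue L + measure lebesgue Q + measure lebesgue ((+) (r *\<^sub>R e) ` P)"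
    by (intro order_trans[OF measure_Un_le] add_mono measure_Un_le order_refl)
       (simp_all add: fmeasurableD measurable_translation sets.Un)
  also have "\<dots> = measure lebesgue L + measure lebesgue P + 2 * R * r"
    by (simp add: measure_translation Q)
  also have "measure lebesgue L + measure lebesgue P = measure lebesgue (L \<union> P)"
  proof -
    have "x \<notin> L \<or> x \<notin> P" for x by (auto simp: L_def P_def)
    then show ?thesis by (intro measure_Un_AE[symmetric] AE_I2) simp_all
  qed
  also have "\<dots> \<le> measure lebesgue (cball (0::real^2) R)"
    by (intro measure_mono_fmeasurable) (auto simp: L_def P_def fmeasurableD)
  also have "\<dots> = pi * R\<^sup>2"
    using assms content_cball[of R "0::real^2"] by (simp add: unit_ball_vol_2)
  finally have "measure lebesgue (tube R r e) \<le> 2 * R * r + pi * R\<^sup>2" by simp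
  moreover have "measure lborel (tube R r u) = measure lborel (tube R r e)"
    using measure_frame_image[OF assms(1) compact_tube, of R r "axis 1 1"]
    by (simp add: frame_image_tube[OF assms(1)] e_def)
  ultimately show ?thesis by simp
qed

text \<open>In the frame of \<open>w\<close>, the strip of the tube with abscissa in
  \<open>[r / 2, r]\<close> and height in \<open>[R - \<eta>, R]\<close> lies entirely beyond the
  side of the other tube: its component along \<open>perp u\<close> exceeds
  \<open>R\<close>.\<close>

lemma measure_tube_diff_ge:
  fixes u w :: "real^2"
  assumes "norm u = 1" "norm w = 1" "R > 0" "r \<ge> 0" "0 \<le> \<eta>" "\<eta> \<le> R"
    and cos: "w \<bullet> u \<ge> 0" and sin: "w \<bullet> perp u > 0" and gap: "(r / 2 - R) * (w \<bullet> perp u) > \<eta>"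
  shows "measure lborel (tube R r w - tube R r u) \<ge> \<eta> * r / 2"
proof -
  define c s where "c = w \<bullet> u" and "s = w \<bullet> perp u"
  have sums: "(u $ 1)\<^sup>2 + (u $ 2)\<^sup>2 = 1" "(w $ 1)\<^sup>2 + (w $ 2)\<^sup>2 = 1"
    using assms(1,2) norm_sq_2[of u] norm_sq_2[of w] by auto
  have "c\<^sup>2 + s\<^sup>2 = ((u $ 1)\<^sup>2 + (u $ 2)\<^sup>2) * ((w $ 1)\<^sup>2 + (w $ 2)\<^sup>2)"
    by (simp add: c_def s_def perp_def inner_vec_def sum_2 power2_eq_square algebra_simps)
  then have cs: "c\<^sup>2 + s\<^sup>2 = 1" by (simp add: sums)
  have c: "0 \<le> c" "c \<le> 1" and "s > 0"
    using cos sin power2_le_imp_le[of c 1] cs zero_le_power2[of s]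
    unfolding c_def[symmetric] s_def[symmetric] one_power2 by linarith+
  have "1 \<le> c + s"
  proof (rule power2_le_imp_le)
    show "1\<^sup>2 \<le> (c + s)\<^sup>2" using cs c \<open>s > 0\<close> by (simp add: power2_sum)
  qed (use c \<open>s > 0\<close> in auto)
  define Q where "Q = cbox (vector [r / 2, R - \<eta>] :: real^2) (vector [r, R])"
  have "frame w ` Q \<subseteq> tube R r w - tube R r u"
  proof
    fix a assume "a \<in> frame w ` Q"
    then obtain t y where ty: "r / 2 \<le> t" "t \<le> r" "R - \<eta> \<le> y" "y \<le> R"
      and a: "a = t *\<^sub>R w + y *\<^sub>R perp w"
      by (auto simp: Q_def mem_box_cart forall_2 frame_def)
    have "a \<in> tube R r w"
      unfolding tube_def using ty assms by (auto simp: a dist_norm intro!: bexI[of _ t])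
    moreover have "a \<notin> tube R r u"
    proof
      assume "a \<in> tube R r u"
      then obtain t' where t': "norm (a - t' *\<^sub>R u) \<le> R"
        by (auto simp: tube_def dist_norm norm_minus_commute)
      \<comment> \<open>Projecting on \<open>perp u\<close> removes the unknown axis position
        \<open>t'\<close>.\<close>
      have "a \<bullet> perp u = (a - t' *\<^sub>R u) \<bullet> perp u"
        by (simp add: inner_vec_def sum_2 perp_def algebra_simps)
      also have "\<dots> \<le> norm (a - t' *\<^sub>R u) * norm (perp u)" by (rule norm_cauchy_schwarz)
      also have "\<dots> \<le> R" using t' assms(1) by simp
      finally have "a \<bullet> perp u \<le> R" .
      moreover have "a \<bullet> perp u = t * s + y * c"
        by (simp add: a s_def c_def inner_vec_def sum_2 perp_def algebra_simps)
      \<comment> \<open>With \<open>c \<ge> 1 - s\<close> and \<open>c \<le> 1\<close>, these bounds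
        give \<open>t * s + y * c \<ge> R + (r / 2 - R) * s - \<eta>\<close>, which exceeds
        \<open>R\<close> by \<open>gap\<close>.\<close>
      moreover have "t * s \<ge> r / 2 * s" using ty \<open>s > 0\<close> by (intro mult_right_mono) auto
      moreover have "y * c \<ge> (R - \<eta>) * c" using ty c by (intro mult_right_mono) auto
      moreover have "\<eta> * c \<le> \<eta> * 1" using c assms by (intro mult_left_mono) auto
      moreover have "R * (c + s) \<ge> R * 1" using \<open>1 \<le> c + s\<close> assms by (intro mult_left_mono) auto
      moreover have "r / 2 * s - R * s > \<eta>" using gap by (simp add: s_def algebra_simps)
      ultimately show False by (simp add: algebra_simps)
    qed
    ultimately show "a \<in> tube R r w - tube R r u" by blast
  qed
  then have "measure lborel (frame w ` Q) \<le> measure lborel (tube R r w - tube R r u)"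
  proof (rule measure_mono_fmeasurable)
    have "compact (frame w ` Q)"
      unfolding Q_def by (intro compact_frame_image assms compact_cbox)
    then show "frame w ` Q \<in> sets lborel" by (simp add: borel_closed compact_imp_closed)
    show "tube R r w - tube R r u \<in> fmeasurable lborel"
      by (intro fmeasurable.Diff fmeasurable_compact compact_tube)
  qed
  moreover have "measure lborel (frame w ` Q) = measure lborel Q"
    by (intro measure_frame_image assms) (simp add: Q_def)
  moreover have "measure lborel Q = \<eta> * r / 2"
  proof -
    have "Q \<noteq> {}" unfolding Q_def using assms by (simp add: interval_ne_empty_cart forall_2)
    then show ?thesis unfolding Q_def by (simp add: content_cbox_cart UNIV_2)
  qed
  ultimately show ?thesis by simp
qed

text \<open>On \<open>[0, 1]\<close> the derivative \<open>cos z\<close> is at least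
  \<open>1 / 2\<close>, because 1 is below \<open>pi / 3\<close>.\<close>

lemma sin_ge_half:
  fixes x :: real
  assumes "0 \<le> x" "x \<le> 1"
  shows "sin x \<ge> x / 2"
proof -
  have "sin 0 - 0 / 2 \<le> sin x - x / 2"
  proof (rule DERIV_nonneg_imp_nondecreasing[where f = "\<lambda>x. sin x - x / 2", OF assms(1)])
    fix z assume z: "0 \<le> z" "z \<le> x"
    have "cos (pi / 3) \<le> cos z"
      using z assms pi_gt3 by (intro cos_monotone_0_pi_le) auto
    then have "cos z - 1 / 2 \<ge> 0" by (simp add: cos_60)
    moreover have "((\<lambda>x. sin x - x / 2) has_real_derivative (cos z - 1 / 2)) (at z)"
      by (auto intro!: derivative_eq_intros)
    ultimately show "\<exists>y. ((\<lambda>x. sin x - x / 2) has_real_derivative y) (at z) \<and> 0 \<le> y" by blast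
  qed
  then show ?thesis by simp
qed

section \<open>Probability estimates for finitely many vacant tubes\<close>

lemma (in poisson_process) vacant_origin_eq:
  "{\<omega>\<in>space M. 0 \<notin> occupied_phase R (X \<omega>)} = {\<omega>\<in>space M. X \<omega> \<inter> cball 0 R = {}}"
  by (auto simp: occupied_phase_def dist_commute)

text \<open>Both tubes are vacant exactly when their union is. Its area exceeds that of one tube by
  at least \<open>\<eta> * r / 2\<close>, which becomes a factor in the void probability.\<close>

lemma prob_tubes_both_vacant_le:
  fixes X :: "'w \<Rightarrow> (real^2) set"
  assumes "poisson_process M X"
    and tubes: "norm u = 1" "norm w = 1" "R > 0" "r \<ge> 0" "0 \<le> \<eta>" "\<eta> \<le> R"
      "w \<bullet> u \<ge> 0" "w \<bullet> perp u > 0" "(r / 2 - R) * (w \<bullet> perp u) > \<eta>"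
  shows "\<P>(\<omega> in M. X \<omega> \<inter> tube R r u = {} \<and> X \<omega> \<inter> tube R r w = {})
    \<le> exp (- (\<eta> * r / 2)) * \<P>(\<omega> in M. X \<omega> \<inter> tube R r u = {})"
proof -
  interpret poisson_process M X by fact
  have "measure lborel (tube R r u \<union> tube R r w)
      = measure lborel (tube R r u) + measure lborel (tube R r w - tube R r u)"
    by (intro measure_Un2 fmeasurable_compact compact_tube)
  then have "measure lborel (tube R r u \<union> tube R r w) \<ge> measure lborel (tube R r u) + \<eta> * r / 2"
    using measure_tube_diff_ge[OF tubes] by simp
  moreover have "\<P>(\<omega> in M. X \<omega> \<inter> tube R r u = {} \<and> X \<omega> \<inter> tube R r w = {})
      = \<P>(\<omega> in M. X \<omega> \<inter> (tube R r u \<union> tube R r w) = {})"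
    by (simp add: Int_Un_distrib)
  ultimately show ?thesis
    by (simp add: void_event(2) bounded_tube exp_add[symmetric])
qed

text \<open>Bonferroni's inequality is applied to \<open>n\<close> equally spaced directions.
  Dividing by the probability \<open>exp (- (pi * R\<^sup>2))\<close> of the conditioning event
  cancels the contribution of the caps of the tubes.\<close>

lemma cond_prob_total_visibility_ge:
  fixes X :: "'w \<Rightarrow> (real^2) set" and n :: nat
  assumes "poisson_process M X" and "R > 0" "r > 0" "0 \<le> \<eta>" "\<eta> \<le> R" "n > 0"
    and gap: "(r / 2 - R) / (2 * n) > \<eta>" and small: "n * exp (- (\<eta> * r / 2)) \<le> 1"
  shows "\<P>(\<omega> in M. total_visibility (occupied_phase R (X \<omega>)) \<ge> ereal r
      \<bar> 0 \<notin> occupied_phase R (X \<omega>))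
    \<ge> n * exp (- 2 * R * r) * (1 - n * exp (- (\<eta> * r / 2)))"
proof -
  interpret poisson_process M X by fact
  define \<kappa> where "\<kappa> = exp (- (\<eta> * r / 2))"
  \<comment> \<open>For indices below \<open>n\<close> the angles lie in \<open>[0, 1)\<close>.
    Their positive differences are thus at most 1, where \<open>sin_ge_half\<close> applies and the
    cosine is nonnegative.\<close>
  define u where "u i = (vector [cos (real i / n), sin (real i / n)] :: real^2)" for i :: nat
  have norm_u: "norm (u i) = 1" for i
    unfolding u_def by (rule power2_eq_imp_eq) (simp_all add: norm_sq_2)
  define A where "A i = {\<omega>\<in>space M. X \<omega> \<inter> tube R r (u i) = {}}" for i
  have A_sets [measurable]: "A i \<in> sets M" for i
    unfolding A_def by (intro void_event tube_sets_borel bounded_tube)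
  have prob_A: "prob (A i) \<ge> exp (- (2 * R * r + pi * R\<^sup>2))" for i
    unfolding A_def void_event(2)[OF tube_sets_borel bounded_tube]
    using measure_tube_le[OF norm_u[of i] \<open>R > 0\<close>, of r] \<open>r > 0\<close> by simp
  have pair: "prob (A i \<inter> A j) \<le> \<kappa> * prob (A i)" if "i < j" "j < n" for i j
  proof -
    define x where "x = real j / n - real i / n"
    have "real j / n < 1" using that by simp
    then have "x \<le> 1" unfolding x_def using divide_nonneg_nonneg[of "real i" n] by linarith
    have "1 / n \<le> x"
      using that by (simp add: x_def diff_divide_distrib[symmetric] divide_right_mono)
    have "0 < 1 / real n" using \<open>n > 0\<close> by simp
    with \<open>1 / n \<le> x\<close> have "0 < x" by linarith
    have w_u: "u j \<bullet> u i = cos x" "u j \<bullet> perp (u i) = sin x"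
      by (simp_all add: u_def perp_def x_def inner_vec_def sum_2 cos_diff sin_diff)
    \<comment> \<open>The smallest angular difference is \<open>1 / n\<close>; this is the source of
      the denominator \<open>2 * n\<close> in \<open>gap\<close>.\<close>
    have "1 / (2 * n) \<le> sin x"
      using sin_ge_half[of x] \<open>0 < x\<close> \<open>x \<le> 1\<close> \<open>1 / n \<le> x\<close> by simp
    moreover have pos: "r / 2 - R > 0"
    proof -
      have "0 < (r / 2 - R) / (2 * n)" using gap \<open>0 \<le> \<eta>\<close> by linarith
      then show ?thesis by (simp add: zero_less_divide_iff)
    qed
    ultimately have "(r / 2 - R) * (1 / (2 * n)) \<le> (r / 2 - R) * sin x"
      by (intro mult_left_mono) auto
    then have "\<eta> < (r / 2 - R) * sin x" using gap by simp
    moreover have "sin x > 0" using \<open>0 < x\<close> \<open>x \<le> 1\<close> pi_gt3 by (intro sin_gt_zero) auto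
    moreover have "cos x \<ge> 0" using \<open>0 < x\<close> \<open>x \<le> 1\<close> pi_gt3 by (intro cos_ge_zero) auto
    moreover have "A i \<inter> A j
        = {\<omega>\<in>space M. X \<omega> \<inter> tube R r (u i) = {} \<and> X \<omega> \<inter> tube R r (u j) = {}}"
      by (auto simp: A_def)
    ultimately show ?thesis
      using prob_tubes_both_vacant_le[OF assms(1) norm_u norm_u, of R r \<eta> j i] assms
      by (simp add: w_u A_def \<kappa>_def)
  qed
  define E where "E = {\<omega>\<in>space M. total_visibility (occupied_phase R (X \<omega>)) \<ge> ereal r
    \<and> 0 \<notin> occupied_phase R (X \<omega>)}"
  have "\<omega> \<in> E" if "\<omega> \<in> A i" for \<omega> i
  proof -
    have disj: "X \<omega> \<inter> tube R r (u i) = {}" using that by (simp add: A_def)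
    then have "0 \<notin> occupied_phase R (X \<omega>)"
      unfolding tube_disjoint_iff using \<open>r > 0\<close> by (auto dest!: bspec[of _ _ 0])
    then show ?thesis
      using that total_visibility_ge[OF norm_u disj] by (simp add: E_def A_def)
  qed
  then have "prob (\<Union>i<n. A i) \<le> prob E"
    using total_visibility_event_sets[OF \<open>r > 0\<close>]
    by (intro finite_measure_mono) (auto simp: E_def)
  moreover have "prob (\<Union>i<n. A i) \<ge> (\<Sum>i<n. prob (A i)) - (\<Sum>j<n. \<Sum>i<j. prob (A i \<inter> A j))"
    by (rule measure_UN_Bonferroni) simp
  \<comment> \<open>Extending each inner sum to all \<open>i < n\<close> is crude but leaves a
    multiple \<open>n * \<kappa>\<close> of the first-order sum, which can be factored out.\<close>
  moreover have "(\<Sum>j<n. \<Sum>i<j. prob (A i \<inter> A j)) \<le> (\<Sum>j<n. \<Sum>i<n. \<kappa> * prob (A i))"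
  proof (rule sum_mono)
    fix j assume "j \<in> {..<n}"
    then have "(\<Sum>i<j. prob (A i \<inter> A j)) \<le> (\<Sum>i<j. \<kappa> * prob (A i))"
      by (intro sum_mono pair) auto
    also have "\<dots> \<le> (\<Sum>i<n. \<kappa> * prob (A i))"
      using \<open>j \<in> {..<n}\<close> by (intro sum_mono2) (auto simp: \<kappa>_def)
    finally show "(\<Sum>i<j. prob (A i \<inter> A j)) \<le> (\<Sum>i<n. \<kappa> * prob (A i))" .
  qed
  moreover have "(\<Sum>j<n. \<Sum>i<n. \<kappa> * prob (A i)) = n * \<kappa> * (\<Sum>i<n. prob (A i))"
    by (simp add: sum_distrib_left mult.assoc)
  moreover have "(\<Sum>i<n. prob (A i)) * (1 - n * \<kappa>)
      = (\<Sum>i<n. prob (A i)) - n * \<kappa> * (\<Sum>i<n. prob (A i))"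
    by (simp add: right_diff_distrib)
  ultimately have "prob E \<ge> (\<Sum>i<n. prob (A i)) * (1 - n * \<kappa>)" by linarith
  \<comment> \<open>The assumption \<open>small\<close> makes \<open>1 - n * \<kappa>\<close>
    nonnegative, so the lower bounds on the single probabilities survive the multiplication.\<close>
  moreover have "(\<Sum>i<n. prob (A i)) * (1 - n * \<kappa>)
      \<ge> n * exp (- (2 * R * r + pi * R\<^sup>2)) * (1 - n * \<kappa>)"
    using sum_mono[of "{..<n}" "\<lambda>_. exp (- (2 * R * r + pi * R\<^sup>2))" "\<lambda>i. prob (A i)"] prob_A small
    by (intro mult_right_mono) (auto simp: \<kappa>_def)
  ultimately have "n * exp (- (2 * R * r + pi * R\<^sup>2)) * (1 - n * \<kappa>) \<le> prob E" by linarith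
  moreover have "prob {\<omega>\<in>space M. 0 \<notin> occupied_phase R (X \<omega>)} = exp (- (pi * R\<^sup>2))"
    unfolding vacant_origin_eq using \<open>R > 0\<close>
    by (subst void_event(2)) (auto simp: content_cball unit_ball_vol_2)
  ultimately show ?thesis
    unfolding cond_prob_def
    by (simp add: E_def[symmetric] \<kappa>_def[symmetric] pos_le_divide_eq)
       (simp add: exp_add[symmetric] algebra_simps)
qed

section \<open>Choice of parameters and passage to the limit\<close>

theorem mainTheorem5:
  fixes M :: "'w measure" and X :: "'w \<Rightarrow> (real^2) set" and R :: real
  assumes "poisson_process M X" and "R > 0"
  shows "\<forall>\<mu>\<in>{0<..<2 / R}. \<exists>\<epsilon> :: real \<Rightarrow> real. (\<epsilon> \<longlongrightarrow> 0) at_top \<and>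
    (\<forall>\<^sub>F r in at_top.
      \<P>(\<omega> in M. total_visibility (occupied_phase R (X \<omega>)) \<ge> ereal r
              \<bar> 0 \<notin> occupied_phase R (X \<omega>))
        \<ge> \<mu> * r * exp (- 2 * R * r) * (1 + \<epsilon> r))"
proof
  fix \<mu> assume "\<mu> \<in> {0<..<2 / R}"
  then have "\<mu> > 0" by simp
  \<comment> \<open>With about \<open>\<mu> * r\<close> directions the quantity in
    \<open>gap\<close> tends to \<open>1 / (4 * \<mu>)\<close>. Half of that limit leaves room for
    large \<open>r\<close>, and the cap \<open>R\<close> keeps the strip inside the upper half of
    the tube.\<close>
  define \<eta> where "\<eta> = min R (1 / (8 * \<mu>))"
  have \<eta>: "\<eta> > 0" "\<eta> \<le> R" "\<eta> \<le> 1 / (8 * \<mu>)" using \<open>\<mu> > 0\<close> \<open>R > 0\<close> by (auto simp: \<eta>_def)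
  \<comment> \<open>This is minus the relative Bonferroni loss, with the rounded number of
    directions replaced by its upper bound \<open>\<mu> * r + 1\<close>.\<close>
  define \<epsilon> where "\<epsilon> r = - ((\<mu> * r + 1) * exp (- (\<eta> * r / 2)))" for r
  have lim: "(\<epsilon> \<longlongrightarrow> 0) at_top"
    unfolding \<epsilon>_def using \<open>\<mu> > 0\<close> \<open>\<eta> > 0\<close> by real_asymp
  have "((\<lambda>r. (r / 2 - R) / (2 * (\<mu> * r + 1))) \<longlongrightarrow> 1 / (4 * \<mu>)) at_top"
    using \<open>\<mu> > 0\<close> by (real_asymp simp: field_simps)
  moreover have "1 / (8 * \<mu>) < 1 / (4 * \<mu>)" using \<open>\<mu> > 0\<close> by (simp add: field_simps)
  ultimately have "\<forall>\<^sub>F r in at_top. 1 / (8 * \<mu>) < (r / 2 - R) / (2 * (\<mu> * r + 1))"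
    by (rule order_tendstoD)
  \<comment> \<open>This supplies both the condition \<open>small\<close> and the nonnegativity of
    \<open>1 + \<epsilon> r\<close> used in the final product estimate.\<close>
  moreover have "\<forall>\<^sub>F r in at_top. - 1 < \<epsilon> r"
    using lim by (rule order_tendstoD) simp
  ultimately have "\<forall>\<^sub>F r in at_top.
      \<P>(\<omega> in M. total_visibility (occupied_phase R (X \<omega>)) \<ge> ereal r
              \<bar> 0 \<notin> occupied_phase R (X \<omega>))
        \<ge> \<mu> * r * exp (- 2 * R * r) * (1 + \<epsilon> r)"
    using eventually_gt_at_top[of 0]
  proof eventually_elim
    case (elim r)
    \<comment> \<open>Rounding up keeps the leading factor at least \<open>\<mu> * r\<close>; the
      extra 1 is absorbed in \<open>\<epsilon>\<close> and in the limit above.\<close>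
    define n where "n = nat \<lceil>\<mu> * r\<rceil>"
    have "\<mu> * r > 0" using elim \<open>\<mu> > 0\<close> by simp
    then have n: "\<mu> * r \<le> n" "n \<le> \<mu> * r + 1" "n > 0"
      unfolding n_def by linarith+
    have \<epsilon>: "n * exp (- (\<eta> * r / 2)) \<le> - \<epsilon> r"
      using n by (simp add: \<epsilon>_def)
    have "(r / 2 - R) / (2 * (\<mu> * r + 1)) > 0"
      using elim(1) \<open>\<mu> > 0\<close> by (intro less_trans[OF _ elim(1)]) simp
    then have "r / 2 - R > 0"
      using \<open>\<mu> * r > 0\<close> by (simp add: zero_less_divide_iff)
    then have "(r / 2 - R) / (2 * (\<mu> * r + 1)) \<le> (r / 2 - R) / (2 * n)"
      using n by (intro divide_left_mono) auto
    then have "\<eta> < (r / 2 - R) / (2 * n)" using elim(1) \<eta> by linarith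
    then have "n * exp (- 2 * R * r) * (1 - n * exp (- (\<eta> * r / 2)))
      \<le> \<P>(\<omega> in M. total_visibility (occupied_phase R (X \<omega>)) \<ge> ereal r
              \<bar> 0 \<notin> occupied_phase R (X \<omega>))"
      using \<epsilon> elim n \<eta> assms by (intro cond_prob_total_visibility_ge) auto
    moreover have "\<mu> * r * exp (- 2 * R * r) * (1 + \<epsilon> r)
      \<le> n * exp (- 2 * R * r) * (1 - n * exp (- (\<eta> * r / 2)))"
      using n \<epsilon> elim by (intro mult_mono) auto
    ultimately show ?case by linarith
  qed
  with lim show "\<exists>\<epsilon> :: real \<Rightarrow> real. (\<epsilon> \<longlongrightarrow> 0) at_top \<and>
    (\<forall>\<^sub>F r in at_top.
      \<P>(\<omega> in M. total_visibility (occupied_phase R (X \<omega>)) \<ge> ereal r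
              \<bar> 0 \<notin> occupied_phase R (X \<omega>))
        \<ge> \<mu> * r * exp (- 2 * R * r) * (1 + \<epsilon> r))"
    by blast
qed

end
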